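(* Let $p$ be a prime, let $r\geq 1$ be an integer, and put $q=p^r$. Let $T=T(r)=\left\{ t+\sum_{k\geq 1}a_{qk+1}t^{qk+1} : a_{qk+1}\in\mathbb F_p\right\}$, with group operation given by substitution of formal power series. Then $T$ has infinite obliquity, i.e. $o(T)=\sup_{n}\log_p|\gamma_{n+1}(T):\mu_n(T)|=\infty$.
   Context: Let $p$ be a prime, $r\geq 1$ and $q=p^r$. The group $T(r)$ (a Fesenko group) is the set of formal power series $t+\sum_{k\geq 1}a_{qk+1}t^{qk+1}$ with coefficients $a_{qk+1}\in\mathbb F_p$ under substitution of one power series into another; it is a closed subgroup of the Nottingham group $\left\{ t+\sum_{k\geq 1}a_kt^{k+1} : a_k\in\mathbb F_p\right\}$ and hence a pro-$p$ group. For a pro-$p$ group $G$, $\gamma_n(G)$ denotes the $n$-th term of the lower central series of $G$, with $\gamma_1(G)=G$ and $\gamma_{n+1}(G)=[\gamma_n(G),G]$ (closed subgroups, as is usual for pro-$p$ groups). For $n\geq 1$ define $$\mu_n(G)=\gamma_{n+1}(G)\cap\bigcap\{N : N\text{ is a closed normal subgroup of } G,\ N\not\leq\gamma_{n+1}(G)\}.$$ The obliquity of $G$ is $o(G)=\sup_n\log_p|\gamma_{n+1}(G):\mu_n(G)|\in\mathbb N\cup\{\infty\}$. *)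

theory Defs
  imports "HOL-Analysis.Analysis" "HOL-Algebra.Generated_Groups"
begin

text \<open>
  A topological group is given by a group \<open>G\<close> together with a topology \<open>X\<close> on its carrier.
  \<open>lower_central_series X G n\<close> is the closed term $\gamma_n(G)$, with $\gamma_1(G) = G$;
  the value at index 0 is a dummy.
\<close>

fun lower_central_series :: "'g topology \<Rightarrow> ('g, 'm) monoid_scheme \<Rightarrow> nat \<Rightarrow> 'g set" where
  "lower_central_series X G 0 = carrier G"
| "lower_central_series X G (Suc 0) = carrier G"
| "lower_central_series X G (Suc (Suc n)) =
     X closure_of
       generate G {x \<otimes>\<^bsub>G\<^esub> y \<otimes>\<^bsub>G\<^esub> inv\<^bsub>G\<^esub> x \<otimes>\<^bsub>G\<^esub> inv\<^bsub>G\<^esub> y | x y.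
                     x \<in> lower_central_series X G (Suc n) \<and> y \<in> carrier G}"

definition oblique_core :: "'g topology \<Rightarrow> ('g, 'm) monoid_scheme \<Rightarrow> nat \<Rightarrow> 'g set" where
  "oblique_core X G n =
     lower_central_series X G (n + 1) \<inter>
     \<Inter> {N. N \<lhd> G \<and> closedin X N \<and> \<not> N \<subseteq> lower_central_series X G (n + 1)}"

text \<open>
  The base-\<open>p\<close> logarithm of the index of the subgroup \<open>K\<close> in the subgroup \<open>H\<close>.  Since \<^const>\<open>card\<close> is 0
  on infinite sets, infinite index is treated separately.
\<close>

definition log_index :: "nat \<Rightarrow> ('g, 'm) monoid_scheme \<Rightarrow> 'g set \<Rightarrow> 'g set \<Rightarrow> ereal" where
  "log_index p G H K =
     (let C = rcosets\<^bsub>G\<lparr>carrier := H\<rparr>\<^esub> K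
      in if finite C then ereal (log (real p) (real (card C))) else \<infinity>)"

definition obliquity :: "nat \<Rightarrow> 'g topology \<Rightarrow> ('g, 'm) monoid_scheme \<Rightarrow> ereal" where
  "obliquity p X G =
     (SUP n\<in>{1..}. log_index p G (lower_central_series X G (n + 1)) (oblique_core X G n))"

text \<open>
  The Fesenko group \<open>T(r)\<close>, with $q = p^r$ and coefficients in a field \<open>'a\<close> which is to be
  $\mathbb{F}_p$.  Since \<open>fps_compose f g\<close> is $f(g(t))$, the product substitutes the second series
  into the first.
\<close>

definition fesenko_group :: "nat \<Rightarrow> 'a::field fps monoid" where
  "fesenko_group q =
     \<lparr>carrier = {fps_X + h | h. \<forall>n. fps_nth h n \<noteq> 0 \<longrightarrow> (\<exists>k\<ge>1. n = q * k + 1)},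
      monoid.mult = fps_compose,
      one = fps_X\<rparr>"

text \<open>
  The topology is induced by the \<open>t\<close>-adic metric on formal power series, which is the library's
  metric on \<^typ>\<open>'a fps\<close>.
\<close>

definition fesenko_topology :: "nat \<Rightarrow> 'a::field fps topology" where
  "fesenko_topology q = top_of_set (carrier (fesenko_group q))"

end

theory Submission
  imports Defs "HOL-Number_Theory.Residues"
begin

text \<open>
  Every element of $T$ has the form $t\,u(t)^q$ with $u(0) = 1$; call the order of $u - 1$ its depth.
  Commutation with an arbitrary element raises the depth by at least $q$, so $\gamma_{n+1}$ has depth
  at least $1 + nq$. Commutation with $t(1+t)^q$ raises the depth by exactly $q$ whenever the depth
  is at least $2$ and prime to $p$, so $\gamma_{n+1}$ contains elements of every depth $l + nq$ with
  $l \geq 2$ and $p \nmid l$.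

  Now let $d = nq$ be a power of $p$ and let $N$ consist of the elements with
  $u \equiv 1 + b t^d \pmod{t^{2d}}$ for some $b$. Since $d$ is a power of $p$, raising to the power
  $d$ is additive, and $N$ turns out to be central modulo depth $2d$, hence normal. It contains
  elements of depth $d$, so $N \not\leq \gamma_{n+1}$, but it has none of depth strictly between $d$
  and $2d$. The many elements of $\gamma_{n+1}$ with such depths therefore lie in distinct
  cosets of $\mu_n$.
\<close>

unbundle fps_syntax
no_notation vec_nth (infixl \<open>$\<close> 90)

subsection \<open>Composition and the order of a power series\<close>

lemma fps_X_power_dvd_iff:
  fixes h :: "'a::comm_ring_1 fps"
  shows "fps_X ^ m dvd h \<longleftrightarrow> (\<forall>i<m. h $ i = 0)"
proof
  assume "\<forall>i<m. h $ i = 0"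
  then have "h = fps_X ^ m * fps_shift m h"
    by (intro fps_ext) (simp add: fps_X_power_mult_nth)
  then show "fps_X ^ m dvd h" by (metis dvd_triv_left)
qed (auto simp: fps_X_power_mult_nth elim!: dvdE)

lemma fps_X_power_dvd_compose:
  fixes h g :: "'a::idom fps"
  assumes "fps_X ^ m dvd h" "g $ 0 = 0"
  shows "fps_X ^ m dvd (h oo g)"
proof -
  obtain k where "h = fps_X ^ m * k" using assms(1) by blast
  then have "h oo g = g ^ m * (k oo g)"
    using assms(2) by (simp add: fps_compose_mult_distrib fps_X_power_compose)
  moreover have "fps_X ^ 1 dvd g" using assms(2) unfolding fps_X_power_dvd_iff by simp
  ultimately show ?thesis by (simp add: dvd_mult2 dvd_power_same)
qed

text \<open>Orders multiply under composition, so substituting a series of order one leaves the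
  order unchanged. Depths can therefore be read off after such a substitution.\<close>

lemma fps_X_power_dvd_composeD:
  fixes h g :: "'a::field fps"
  assumes "fps_X ^ m dvd (h oo g)" "subdegree g = 1"
  shows "fps_X ^ m dvd h"
proof (cases "h = 0")
  case False
  have g0: "g $ 0 = 0" using assms(2) by (metis nth_less_subdegree_zero zero_less_one)
  have "g \<noteq> 0" using assms(2) by auto
  with False g0 have "h oo g \<noteq> 0" by (simp add: fps_compose_eq_0_iff)
  with assms g0 False show ?thesis
    by (simp add: fps_dvd_iff fps_X_power_subdegree)
qed auto

lemma fps_X_power_dvd_unit_multD:
  fixes y h :: "'a::field fps"
  assumes "fps_X ^ m dvd y * h" "y $ 0 \<noteq> 0"
  shows "fps_X ^ m dvd h"
  using assms by (metis dvd_mult dvd_refl inverse_mult_eq_1 mult.assoc mult_1 dvd_trans)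

lemma one_plus_power_expand:
  fixes y :: "'a::comm_ring_1"
  shows "\<exists>e. (1 + y) ^ i = 1 + of_nat i * y + y ^ 2 * e"
proof (induction i)
  case 0
  show ?case by (auto intro: exI[of _ 0])
next
  case (Suc i)
  then obtain e where "(1 + y) ^ i = 1 + of_nat i * y + y ^ 2 * e" by blast
  then have "(1 + y) ^ Suc i = 1 + of_nat (Suc i) * y + y ^ 2 * (of_nat i + e + y * e)"
    by (simp add: algebra_simps power2_eq_square)
  then show ?case by blast
qed

text \<open>The substitution sends \<open>fps_X ^ i\<close> to itself plus \<open>i * k $ 0\<close>
  at exponent \<open>i + m\<close> plus higher terms. The first change in \<open>w\<close> hence
  comes from its coefficient at \<open>l\<close>, and the factor \<open>l\<close> is why
  divisibility of depths by \<open>p\<close> matters later.\<close>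

lemma fps_compose_diff_leading:
  fixes w k :: "'a::comm_ring_1 fps"
  assumes g: "g = fps_X * (1 + fps_X ^ m * k)" and m: "m \<ge> 1" and w: "fps_X ^ l dvd w"
  shows "fps_X ^ (l + m) dvd (w oo g) - w"
    and "((w oo g) - w) $ (l + m) = of_nat l * w $ l * k $ 0"
proof -
  \<comment> \<open>The quadratic remainder starts at exponent \<open>i + 2 * m\<close>, which is
    beyond \<open>i + m\<close> because \<open>m\<close> is positive.\<close>
  have pw: "g ^ i $ n = (if n = i then 1 else 0) + (if n = i + m then of_nat i * k $ 0 else 0)"
    if "n \<le> i + m" for i n
  proof -
    obtain e where e: "(1 + fps_X ^ m * k) ^ i
        = 1 + of_nat i * (fps_X ^ m * k) + (fps_X ^ m * k) ^ 2 * e"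
      using one_plus_power_expand by blast
    have "g ^ i = fps_X ^ i + fps_X ^ (i + m) * (of_nat i * k + fps_X ^ m * (k ^ 2 * e))"
      unfolding g power_mult_distrib e
      by (simp add: algebra_simps power_add power2_eq_square)
    then show ?thesis using that m
      by (auto simp: fps_X_power_mult_nth fps_mult_of_nat_nth)
  qed
  have w0: "w $ i = 0" if "i < l" for i using w that by (simp add: fps_X_power_dvd_iff)
  have key: "((w oo g) - w) $ n = (if n = l + m then of_nat l * w $ l * k $ 0 else 0)"
    if n: "n \<le> l + m" for n
  proof -
    have "(w oo g) $ n = (\<Sum>i=0..n. (if i = n then w $ n else 0)
        + (if i = l then if n = l + m then of_nat l * w $ l * k $ 0 else 0 else 0))"
      unfolding fps_compose_nth
    proof (rule sum.cong[OF refl])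
      fix i assume "i \<in> {0..n}"
      show "w $ i * g ^ i $ n = (if i = n then w $ n else 0)
        + (if i = l then if n = l + m then of_nat l * w $ l * k $ 0 else 0 else 0)"
      proof (cases "i < l")
        case True
        then show ?thesis by (auto simp: w0)
      next
        case False
        then show ?thesis using n m by (subst pw) (auto simp: algebra_simps)
      qed
    qed
    then show ?thesis by (simp add: sum.distrib)
  qed
  show "fps_X ^ (l + m) dvd (w oo g) - w" unfolding fps_X_power_dvd_iff using key by auto
  show "((w oo g) - w) $ (l + m) = of_nat l * w $ l * k $ 0" using key by simp
qed

subsection \<open>The group in the coordinate \<open>u\<close>\<close>

locale fesenko =
  fixes p r q :: nat and ty :: "'a::field itself"
  assumes prime_p: "prime p" and r: "r \<ge> 1" and q: "q = p ^ r" and card: "CARD('a) = p"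
begin

section \<open>Characteristic \<open>p\<close> and the Frobenius map\<close>

lemma CHAR_eq: "CHAR('a) = p"
proof -
  have "CHAR('a) dvd p" using CHAR_dvd_CARD[where 'a='a] card by simp
  moreover have "CHAR('a) \<noteq> 1" by simp
  ultimately show ?thesis using prime_p prime_nat_iff by blast
qed

lemma q_ge_2: "q \<ge> 2"
  using prime_p r q by (metis le_trans not_less_eq_eq numeral_2_eq_2 power_one_right
      power_increasing prime_ge_2_nat prime_ge_1_nat)

lemma freshman_fps: "(x + y :: 'a fps) ^ (p ^ j) = x ^ (p ^ j) + y ^ (p ^ j)"
  using prime_p by (intro freshmans_dream') (simp_all add: CHAR_eq)

lemma freshman_diff_fps: "(x - y :: 'a fps) ^ (p ^ j) = x ^ (p ^ j) - y ^ (p ^ j)"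
  using freshman_fps[of "x - y" y j] by simp

lemma power_q_diff_fps: "(x - y :: 'a fps) ^ q = x ^ q - y ^ q"
  using freshman_diff_fps[of x y r] q by simp

lemma frobenius_inj: "inj (\<lambda>x :: 'a. x ^ q)"
proof (rule injI)
  fix x y :: 'a assume "x ^ q = y ^ q"
  moreover have "(x - y + y) ^ q = (x - y) ^ q + y ^ q"
    using prime_p q by (intro freshmans_dream'[where n = r]) (simp_all add: CHAR_eq)
  ultimately have "(x - y) ^ q = 0" by simp
  then show "x = y" by simp
qed

lemma frobenius_surj: "surj (\<lambda>x :: 'a. x ^ q)"
proof -
  have "finite (UNIV :: 'a set)" using card prime_p by (metis card_ge_0_finite prime_gt_0_nat)
  then show ?thesis using frobenius_inj by (rule finite_UNIV_inj_surj)
qed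

text \<open>Additivity of the Frobenius map rules out cross terms: each monomial is raised to the
  power \<open>q\<close> separately.\<close>

lemma fps_power_q_nth:
  fixes u :: "'a fps"
  shows "(u ^ q) $ n = (if q dvd n then (u $ (n div q)) ^ q else 0)"
proof -
  \<comment> \<open>Truncate \<open>u\<close>, so that the Frobenius map distributes over a finite sum.\<close>
  define v where "v = (\<Sum>i\<le>n. fps_const (u $ i) * fps_X ^ i)"
  have v: "v $ i = u $ i" if "i \<le> n" for i
    using that by (simp add: v_def fps_sum_nth if_distrib cong: if_cong)
  have "fps_X ^ Suc n dvd u - v" unfolding fps_X_power_dvd_iff using v by simp
  then have "fps_X ^ Suc n dvd (u - v) ^ q" 
    using q_ge_2 by (elim dvd_trans) (simp add: dvd_power)
  then have "fps_X ^ Suc n dvd u ^ q - v ^ q" by (simp add: power_q_diff_fps)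
  then have "(u ^ q) $ n = (v ^ q) $ n" unfolding fps_X_power_dvd_iff by auto
  also have "v ^ q = (\<Sum>i\<le>n. (fps_const (u $ i) * fps_X ^ i) ^ q)"
    unfolding v_def using prime_p q
    by (intro freshmans_dream_sum'[where n = r]) (simp_all add: CHAR_eq)
  also have "\<dots> = (\<Sum>i\<le>n. fps_const ((u $ i) ^ q) * fps_X ^ (q * i))"
    by (simp add: power_mult_distrib fps_const_power mult.commute flip: power_mult)
  also have "\<dots> $ n = (\<Sum>i\<le>n. if n = q * i then (u $ i) ^ q else 0)"
    by (simp add: fps_sum_nth if_distrib cong: if_cong)
  also have "\<dots> = (if q dvd n then (u $ (n div q)) ^ q else 0)"
  proof (cases "q dvd n")
    case True
    then obtain k where k: "n = q * k" by blast
    have "(\<Sum>i\<le>n. if n = q * i then (u $ i) ^ q else 0) = (\<Sum>i\<le>n. if i = k then (u $ k) ^ q else 0)"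
      using k q_ge_2 by (intro sum.cong) auto
    with k q_ge_2 show ?thesis by simp
  qed (auto intro!: sum.neutral)
  finally show ?thesis .
qed

text \<open>The coordinate map of the group: it is a bijection from the series with constant term 1
  onto the carrier, and the exponents \<open>q * k + 1\<close> become consecutive exponents
  \<open>k\<close>.\<close>

definition \<phi> :: "'a fps \<Rightarrow> 'a fps" where "\<phi> u = fps_X * u ^ q"

abbreviation T :: "'a fps monoid" where "T \<equiv> fesenko_group q"

lemma \<phi>_nth: "\<phi> u $ n = (if \<exists>k. n = q * k + 1 then (u $ ((n - 1) div q)) ^ q else 0)"
  using q_ge_2 by (cases n) (auto simp: \<phi>_def fps_power_q_nth dvd_def)

lemma \<phi>_diff: "\<phi> (u - v) = \<phi> u - \<phi> v"
  by (simp add: \<phi>_def power_q_diff_fps right_diff_distrib)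

lemma \<phi>_dvd_iff: "fps_X ^ (q * m + 1) dvd \<phi> h \<longleftrightarrow> fps_X ^ m dvd h"
proof
  assume *: "fps_X ^ (q * m + 1) dvd \<phi> h"
  have "h $ i = 0" if "i < m" for i
  proof -
    have "q * i + 1 < q * m + 1" using that q_ge_2 by simp
    then have "\<phi> h $ (q * i + 1) = 0" using * unfolding fps_X_power_dvd_iff by blast
    then show ?thesis using q_ge_2 by (simp add: \<phi>_nth)
  qed
  then show "fps_X ^ m dvd h" by (simp add: fps_X_power_dvd_iff)
next
  assume "fps_X ^ m dvd h"
  then have "(fps_X ^ m) ^ q dvd h ^ q" by (rule dvd_power_same)
  then show "fps_X ^ (q * m + 1) dvd \<phi> h"
    by (simp add: \<phi>_def mult.commute mult_dvd_mono flip: power_mult)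
qed

lemma \<phi>_eq_iff [simp]: "\<phi> u = \<phi> v \<longleftrightarrow> u = v"
proof
  assume "\<phi> u = \<phi> v"
  then have "(u - v) ^ q = 0" by (simp add: \<phi>_def power_q_diff_fps)
  then show "u = v" by simp
qed simp

lemma \<phi>_0 [simp]: "\<phi> u $ 0 = 0"
  by (simp add: \<phi>_def)

text \<open>Composition commutes with \<open>q\<close>-th powers, so the product of the group
  becomes a twisted multiplication of coordinates. All later computations take place in this
  form.\<close>

lemma \<phi>_compose: "\<phi> u oo \<phi> v = \<phi> (v * (u oo \<phi> v))"
proof -
  have "\<phi> u oo \<phi> v = \<phi> v * (u oo \<phi> v) ^ q"
    by (simp add: \<phi>_def[of u] fps_compose_mult_distrib fps_compose_power)
  then show ?thesis by (simp add: \<phi>_def power_mult_distrib mult.assoc)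
qed

lemma \<phi>_one: "\<phi> 1 = fps_X"
  by (simp add: \<phi>_def)

lemma subdegree_\<phi>: "u $ 0 = 1 \<Longrightarrow> subdegree (\<phi> u) = 1"
  using q_ge_2 by (intro subdegreeI) (auto simp: \<phi>_nth)

lemma carrier_eq: "carrier T = \<phi> ` {u. u $ 0 = 1}"
proof (intro equalityI subsetI)
  fix f assume "f \<in> carrier T"
  then obtain h where f: "f = fps_X + h" and h: "\<And>n. h $ n \<noteq> 0 \<Longrightarrow> \<exists>k\<ge>1. n = q * k + 1"
    by (auto simp: fesenko_group_def)
  have 1: "h $ 1 = 0" using h[of 1] q_ge_2 by auto
  \<comment> \<open>The coordinate is built coefficient by coefficient from \<open>q\<close>-th
    roots, which exist since Frobenius is surjective on the field.\<close>
  define u where "u = Abs_fps (\<lambda>i. inv_into UNIV (\<lambda>x. x ^ q) (f $ (q * i + 1)))"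
  have u: "(u $ i) ^ q = f $ (q * i + 1)" for i
    using surj_f_inv_f[OF frobenius_surj, of "f $ (q * i + 1)"] by (simp add: u_def)
  have "(u $ 0) ^ q = 1 ^ q" using u[of 0] 1 by (simp add: f)
  then have "u $ 0 = 1" using injD[OF frobenius_inj, of "u $ 0" 1] by blast
  moreover have "\<phi> u = f"
  proof (rule fps_ext)
    fix n
    show "\<phi> u $ n = f $ n"
    proof (cases "\<exists>k. n = q * k + 1")
      case True
      then show ?thesis using q_ge_2 by (auto simp: \<phi>_nth u)
    next
      case False
      then have "n \<noteq> 1" by (auto dest: spec[where x = 0])
      with False h[of n] show ?thesis by (auto simp: \<phi>_nth f)
    qed
  qed
  ultimately show "f \<in> \<phi> ` {u. u $ 0 = 1}" by blast
next
  fix f assume "f \<in> \<phi> ` {u. u $ 0 = 1}"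
  then obtain u where u: "u $ 0 = 1" and f: "f = \<phi> u" by blast
  have "\<exists>k\<ge>1. n = q * k + 1" if "(f - fps_X) $ n \<noteq> 0" for n
  proof -
    have "f $ 1 = 1" using u by (simp add: f \<phi>_nth)
    then have n1: "n \<noteq> 1" using that by (intro notI) simp
    then have "\<phi> u $ n \<noteq> 0" using that by (simp add: f)
    then obtain k where k: "n = q * k + 1" unfolding \<phi>_nth by presburger
    with n1 have "k \<ge> 1" by (cases k) simp_all
    with k show ?thesis by blast
  qed
  then show "f \<in> carrier T"
    unfolding fesenko_group_def by (auto intro!: exI[of _ "f - fps_X"])
qed

section \<open>Group operations and closed subgroups in coordinates\<close>

lemma mult_eq [simp]: "x \<otimes>\<^bsub>T\<^esub> y = x oo y"
  by (simp add: fesenko_group_def)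

lemma one_eq [simp]: "\<one>\<^bsub>T\<^esub> = fps_X"
  by (simp add: fesenko_group_def)

lemma \<phi>_in_carrier: "u $ 0 = 1 \<Longrightarrow> \<phi> u \<in> carrier T"
  by (simp add: carrier_eq)

lemma group_T: "group T"
proof (rule groupI)
  show "x \<otimes>\<^bsub>T\<^esub> y \<in> carrier T" if "x \<in> carrier T" "y \<in> carrier T" for x y
    using that by (auto simp: carrier_eq \<phi>_compose)
  show "\<one>\<^bsub>T\<^esub> \<in> carrier T" using \<phi>_in_carrier[of 1] by (simp add: \<phi>_one)
  fix x assume "x \<in> carrier T"
  then obtain u where u: "u $ 0 = 1" and x: "x = \<phi> u" by (auto simp: carrier_eq)
  show "\<one>\<^bsub>T\<^esub> \<otimes>\<^bsub>T\<^esub> x = x" by (simp add: x)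
  have x1: "x $ 1 \<noteq> 0" using u by (simp add: x \<phi>_nth)
  define y where "y = fps_inv x"
  have y0: "y $ 0 = 0" by (simp add: y_def fps_inv_def)
  \<comment> \<open>The equation \<open>y * (u oo y) ^ q = fps_X\<close> forces this coordinate for
    the compositional inverse.\<close>
  define w where "w = inverse (u oo y)"
  have "x oo y = fps_X" using x1 by (simp add: y_def fps_inv_right x)
  moreover have "x oo y = y * (u oo y) ^ q"
    using y0 by (simp add: x \<phi>_def fps_compose_mult_distrib fps_compose_power)
  moreover have "(u oo y) * w = 1" using u by (simp add: w_def inverse_mult_eq_1')
  ultimately have "y = \<phi> w"
    unfolding \<phi>_def by (metis mult.assoc mult.right_neutral power_mult_distrib power_one)
  moreover have "w $ 0 = 1" using u by (simp add: w_def)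
  ultimately have "y \<in> carrier T" by (simp add: \<phi>_in_carrier)
  moreover have "y oo x = fps_X" using x1 by (simp add: y_def fps_inv x)
  ultimately show "\<exists>y\<in>carrier T. y \<otimes>\<^bsub>T\<^esub> x = \<one>\<^bsub>T\<^esub>" by auto
next
  fix x y z assume "x \<in> carrier T" "y \<in> carrier T" "z \<in> carrier T"
  then show "x \<otimes>\<^bsub>T\<^esub> y \<otimes>\<^bsub>T\<^esub> z = x \<otimes>\<^bsub>T\<^esub> (y \<otimes>\<^bsub>T\<^esub> z)"
    by (auto simp: carrier_eq fps_compose_assoc)
qed

lemma \<phi>_power_form:
  assumes "fps_X ^ m dvd u - 1"
  obtains k where "\<phi> u = fps_X * (1 + fps_X ^ (q * m) * k)"
proof -
  obtain z where "u - 1 = fps_X ^ m * z" using assms by blast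
  then have "u ^ q - 1 = fps_X ^ (q * m) * z ^ q"
    using power_q_diff_fps[of u 1] by (simp add: power_mult_distrib mult.commute flip: power_mult)
  then show ?thesis by (intro that[of "z ^ q"]) (simp add: \<phi>_def algebra_simps)
qed

text \<open>Depth \<open>m\<close> of \<open>v\<close> means that \<open>\<phi> v\<close> agrees
  with the identity up to a factor \<open>1 + fps_X ^ (q * m) * k\<close>, so substitution raises
  orders by \<open>q * m\<close>.\<close>

lemma compose_\<phi>_diff_dvd:
  assumes "fps_X ^ l dvd u" "fps_X ^ m dvd v - 1" "m \<ge> 1"
  shows "fps_X ^ (l + q * m) dvd (u oo \<phi> v) - u"
proof -
  obtain k where "\<phi> v = fps_X * (1 + fps_X ^ (q * m) * k)"
    using \<phi>_power_form assms(2) by blast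
  then show ?thesis using assms q_ge_2 by (intro fps_compose_diff_leading(1)) auto
qed

text \<open>Substitution fixes constants, so the displacement of \<open>u\<close> can be estimated
  from \<open>u - 1\<close>, which has positive order when \<open>u $ 0 = 1\<close>.\<close>

lemma compose_minus_one: "((u - 1) oo g) - (u - 1) = (u oo g) - u" for u g :: "'a fps"
  by (simp add: fps_compose_sub_distrib)

lemma dvd_minus_one: "fps_X ^ 1 dvd u - 1 \<longleftrightarrow> u $ 0 = 1" for u :: "'a fps"
  using fps_X_power_dvd_iff[of 1 "u - 1"] by simp

text \<open>The product has coordinate \<open>v * (u oo \<phi> v)\<close>, and the inverse of
  \<open>\<phi> u\<close> has a coordinate \<open>w\<close> with
  \<open>w = inverse (u oo \<phi> w)\<close>. The closure conditions cover both.\<close>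

lemma subgroup_\<phi>:
  assumes S: "S \<subseteq> {u. u $ 0 = 1}" "1 \<in> S"
    and mult: "\<And>u v. u \<in> S \<Longrightarrow> v \<in> S \<Longrightarrow> u * v \<in> S"
    and inverse: "\<And>u. u \<in> S \<Longrightarrow> inverse u \<in> S"
    and compose: "\<And>u v. u \<in> S \<Longrightarrow> v $ 0 = 1 \<Longrightarrow> u oo \<phi> v \<in> S"
  shows "subgroup (\<phi> ` S) T"
proof -
  interpret T: group T by (rule group_T)
  show ?thesis
  proof
    show "\<phi> ` S \<subseteq> carrier T" using S(1) by (auto simp: carrier_eq)
    show "\<one>\<^bsub>T\<^esub> \<in> \<phi> ` S" using S(2) \<phi>_one by force
    show "x \<otimes>\<^bsub>T\<^esub> y \<in> \<phi> ` S" if "x \<in> \<phi> ` S" "y \<in> \<phi> ` S" for x y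
      using that S(1) by (auto simp: \<phi>_compose intro!: imageI mult compose)
    show "inv\<^bsub>T\<^esub> x \<in> \<phi> ` S" if x: "x \<in> \<phi> ` S" for x
    proof -
      obtain u where u: "u \<in> S" "u $ 0 = 1" "x = \<phi> u" using x S(1) by blast
      have xc: "x \<in> carrier T" using u by (simp add: \<phi>_in_carrier)
      then obtain w where w: "w $ 0 = 1" "inv\<^bsub>T\<^esub> x = \<phi> w"
        using T.inv_closed[of x] unfolding carrier_eq by blast
      have "\<phi> u oo \<phi> w = fps_X" using T.r_inv[OF xc] unfolding w(2) by (simp add: u(3))
      then have "\<phi> (w * (u oo \<phi> w)) = \<phi> 1" by (simp add: \<phi>_compose \<phi>_one)
      then have "w = inverse (u oo \<phi> w)"
        by (metis \<phi>_eq_iff fps_inverse_unique mult.commute)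
      then show ?thesis using u w compose inverse by (metis imageI)
    qed
  qed
qed

lemma closedin_\<phi>:
  assumes S: "S \<subseteq> {u. u $ 0 = 1}" and m: "m \<ge> 1"
    and cong: "\<And>u v. u \<in> S \<Longrightarrow> fps_X ^ m dvd v - u \<Longrightarrow> v \<in> S"
  shows "closedin (fesenko_topology q) (\<phi> ` S)"
proof -
  define M where "M = q * m + 1"
  \<comment> \<open>Membership in \<open>C\<close> depends only on the coefficients below
    \<open>M\<close>, so both \<open>C\<close> and its complement are open.\<close>
  define C where "C = {g. fps_cutoff M g \<in> fps_cutoff M ` \<phi> ` S}"
  have "open (- C)" unfolding open_fps_iff
    by (intro ballI exI[of _ M]) (simp add: C_def subset_iff)
  then have "closed C" by (simp add: closed_def)
  moreover have "\<phi> ` S = carrier T \<inter> C"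
  proof (intro equalityI subsetI)
    fix f assume "f \<in> carrier T \<inter> C"
    then obtain u v where u: "u \<in> S" and f: "f = \<phi> v"
      and *: "fps_cutoff M (\<phi> v) = fps_cutoff M (\<phi> u)"
      by (auto simp: C_def carrier_eq)
    have "fps_X ^ M dvd \<phi> v - \<phi> u"
      using * by (simp add: fps_X_power_dvd_iff fps_cutoff_eq_fps_cutoff_iff)
    then have "fps_X ^ m dvd v - u" unfolding M_def \<phi>_diff[symmetric] \<phi>_dvd_iff .
    then show "f \<in> \<phi> ` S" using cong u f by blast
  qed (use S in \<open>auto simp: C_def carrier_eq\<close>)
  ultimately show ?thesis
    unfolding fesenko_topology_def by (auto simp: closedin_closed)
qed

subsection \<open>Depth and the lower central series\<close>

definition deep :: "nat \<Rightarrow> 'a fps set" where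
  "deep l = {u. fps_X ^ l dvd u - 1}"

lemma deep_nth_0: "l \<ge> 1 \<Longrightarrow> deep l \<subseteq> {u. u $ 0 = 1}"
  unfolding deep_def dvd_minus_one[symmetric] using power_le_dvd by blast

lemma subgroup_deep:
  assumes "l \<ge> 1"
  shows "subgroup (\<phi> ` deep l) T"
proof (rule subgroup_\<phi>)
  show sub: "deep l \<subseteq> {u. u $ 0 = 1}" using assms by (rule deep_nth_0)
  show "1 \<in> deep l" by (simp add: deep_def)
  show "u * v \<in> deep l" if "u \<in> deep l" "v \<in> deep l" for u v
  proof -
    have "u * v - 1 = u * (v - 1) + (u - 1)" by (simp add: algebra_simps)
    then show ?thesis using that unfolding deep_def by (metis dvd_add dvd_mult mem_Collect_eq)
  qed
  show "inverse u \<in> deep l" if "u \<in> deep l" for u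
  proof -
    have "u $ 0 \<noteq> 0" using that sub by auto
    then have "inverse u - 1 = - inverse u * (u - 1)"
      by (simp add: algebra_simps inverse_mult_eq_1')
    then show ?thesis using that unfolding deep_def by simp
  qed
  show "u oo \<phi> v \<in> deep l" if "u \<in> deep l" "v $ 0 = 1" for u v
    using fps_X_power_dvd_compose[of l "u - 1" "\<phi> v"] that
    by (simp add: deep_def fps_compose_sub_distrib)
qed

lemma closedin_deep:
  assumes "l \<ge> 1"
  shows "closedin (fesenko_topology q) (\<phi> ` deep l)"
proof (rule closedin_\<phi>)
  show "v \<in> deep l" if "u \<in> deep l" "fps_X ^ l dvd v - u" for u v
    using dvd_add[of "fps_X ^ l" "v - u" "u - 1"] that by (simp add: deep_def)
qed (use assms deep_nth_0 in auto)

text \<open>Writing the commutator relation without inverses gives a formula for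
  \<open>w - 1\<close>. On the left, the factor in front is a unit and the inner series has order
  one, so the depth of \<open>w\<close> is the order of the difference of the two displacements on
  the right.\<close>

lemma commutator_eq:
  assumes "\<phi> w oo (\<phi> v oo \<phi> u) = \<phi> u oo \<phi> v"
  shows "u * (v oo \<phi> u) * ((w - 1) oo (\<phi> v oo \<phi> u))
    = v * ((u oo \<phi> v) - u) - u * ((v oo \<phi> u) - v)"
proof -
  have "u * (v oo \<phi> u) * (w oo (\<phi> v oo \<phi> u)) = v * (u oo \<phi> v)"
    using assms by (simp add: \<phi>_compose)
  then show ?thesis by (simp add: fps_compose_sub_distrib algebra_simps)
qed

lemma commutator_\<phi>:
  assumes "u $ 0 = 1" "v $ 0 = 1"
  obtains w where "w $ 0 = 1"
    and "\<phi> u \<otimes>\<^bsub>T\<^esub> \<phi> v \<otimes>\<^bsub>T\<^esub> inv\<^bsub>T\<^esub> \<phi> u \<otimes>\<^bsub>T\<^esub> inv\<^bsub>T\<^esub> \<phi> v = \<phi> w"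
    and "u * (v oo \<phi> u) * ((w - 1) oo (\<phi> v oo \<phi> u))
      = v * ((u oo \<phi> v) - u) - u * ((v oo \<phi> u) - v)"
proof -
  interpret T: group T by (rule group_T)
  let ?c = "\<phi> u \<otimes>\<^bsub>T\<^esub> \<phi> v \<otimes>\<^bsub>T\<^esub> inv\<^bsub>T\<^esub> \<phi> u \<otimes>\<^bsub>T\<^esub> inv\<^bsub>T\<^esub> \<phi> v"
  have in_T: "\<phi> u \<in> carrier T" "\<phi> v \<in> carrier T" using assms by (simp_all add: \<phi>_in_carrier)
  then have "?c \<in> carrier T" by (intro T.m_closed T.inv_closed)
  then obtain w where w: "w $ 0 = 1" "?c = \<phi> w" unfolding carrier_eq by blast
  have "?c \<otimes>\<^bsub>T\<^esub> (\<phi> v \<otimes>\<^bsub>T\<^esub> \<phi> u) = \<phi> u \<otimes>\<^bsub>T\<^esub> \<phi> v"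
  proof -
    have "inv\<^bsub>T\<^esub> \<phi> v \<otimes>\<^bsub>T\<^esub> (\<phi> v \<otimes>\<^bsub>T\<^esub> \<phi> u) = \<phi> u"
      using in_T by (simp add: T.m_assoc[symmetric] del: mult_eq one_eq)
    then show ?thesis using in_T by (simp add: T.m_assoc del: mult_eq one_eq)
  qed
  then have "\<phi> w oo (\<phi> v oo \<phi> u) = \<phi> u oo \<phi> v" unfolding w(2) by simp
  then show ?thesis using that w commutator_eq by blast
qed

lemma subdegree_compose_\<phi>: "u $ 0 = 1 \<Longrightarrow> v $ 0 = 1 \<Longrightarrow> subdegree (\<phi> u oo \<phi> v) = 1"
  by (simp add: subdegree_\<phi>)

text \<open>Substituting \<open>\<phi> v\<close> moves \<open>u\<close> at order at least
  \<open>l + q\<close>, and substituting \<open>\<phi> u\<close> moves \<open>v\<close> at order at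
  least \<open>1 + q * l\<close>. The former bound is the smaller one.\<close>

lemma commutator_deep:
  assumes "l \<ge> 1" "u \<in> deep l" "v $ 0 = 1"
  shows "\<phi> u \<otimes>\<^bsub>T\<^esub> \<phi> v \<otimes>\<^bsub>T\<^esub> inv\<^bsub>T\<^esub> \<phi> u \<otimes>\<^bsub>T\<^esub> inv\<^bsub>T\<^esub> \<phi> v \<in> \<phi> ` deep (l + q)"
proof -
  have u0: "u $ 0 = 1" using assms deep_nth_0 by blast
  obtain w where w: "w $ 0 = 1"
      "\<phi> u \<otimes>\<^bsub>T\<^esub> \<phi> v \<otimes>\<^bsub>T\<^esub> inv\<^bsub>T\<^esub> \<phi> u \<otimes>\<^bsub>T\<^esub> inv\<^bsub>T\<^esub> \<phi> v = \<phi> w"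
      "u * (v oo \<phi> u) * ((w - 1) oo (\<phi> v oo \<phi> u))
        = v * ((u oo \<phi> v) - u) - u * ((v oo \<phi> u) - v)"
    using commutator_\<phi> u0 assms(3) by blast
  have v1: "fps_X ^ 1 dvd v - 1" using assms(3) by (simp only: dvd_minus_one)
  have ul: "fps_X ^ l dvd u - 1" using assms(2) by (simp add: deep_def)
  have A: "fps_X ^ (l + q) dvd (u oo \<phi> v) - u"
    using compose_\<phi>_diff_dvd[OF ul v1] unfolding compose_minus_one by simp
  have "fps_X ^ (1 + q * l) dvd (v oo \<phi> u) - v"
    using compose_\<phi>_diff_dvd[OF v1 ul assms(1)] by (simp only: compose_minus_one)
  \<comment> \<open>The difference of the two sides is \<open>(q - 1) * (l - 1)\<close>.\<close>
  moreover have "l + q \<le> 1 + q * l"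
  proof -
    obtain a where "q = Suc a" using q_ge_2 by (cases q) auto
    moreover obtain b where "l = Suc b" using assms(1) by (cases l) auto
    ultimately show ?thesis by simp
  qed
  ultimately have B: "fps_X ^ (l + q) dvd (v oo \<phi> u) - v" by (rule power_le_dvd)
  have "fps_X ^ (l + q) dvd v * ((u oo \<phi> v) - u) - u * ((v oo \<phi> u) - v)"
    by (intro dvd_diff dvd_mult A B)
  then have "fps_X ^ (l + q) dvd (w - 1) oo (\<phi> v oo \<phi> u)"
    unfolding w(3)[symmetric] using u0 assms(3) by (elim fps_X_power_dvd_unit_multD) simp
  then have "w \<in> deep (l + q)"
    unfolding deep_def using fps_X_power_dvd_composeD subdegree_compose_\<phi> u0 assms(3) by blast
  then show ?thesis using w(2) by simp
qed

section \<open>Depths occurring in the lower central series\<close>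

abbreviation lcs :: "nat \<Rightarrow> 'a fps set" where
  "lcs n \<equiv> lower_central_series (fesenko_topology q) T n"

text \<open>Each commutator gains depth \<open>q\<close>. The elements of depth at least a given
  bound form a closed subgroup, which absorbs the generated subgroup and its closure.\<close>

lemma lcs_subset_deep: "lcs (Suc n) \<subseteq> \<phi> ` deep (1 + n * q)"
proof (induction n)
  case 0
  show ?case unfolding deep_def using dvd_minus_one by (auto simp: carrier_eq)
next
  case (Suc n)
  interpret T: group T by (rule group_T)
  have sub: "subgroup (\<phi> ` deep (1 + Suc n * q)) T" by (rule subgroup_deep) simp
  have "generate T {x \<otimes>\<^bsub>T\<^esub> y \<otimes>\<^bsub>T\<^esub> inv\<^bsub>T\<^esub> x \<otimes>\<^bsub>T\<^esub> inv\<^bsub>T\<^esub> y | x y. x \<in> lcs (Suc n) \<and> y \<in> carrier T}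
      \<subseteq> \<phi> ` deep (1 + Suc n * q)"
  proof (rule T.generate_subgroup_incl[OF _ sub], safe)
    fix x y assume "x \<in> lcs (Suc n)" "y \<in> carrier T"
    with Suc obtain u v where uv: "u \<in> deep (1 + n * q)" "x = \<phi> u" "v $ 0 = 1" "y = \<phi> v"
      unfolding carrier_eq by blast
    show "x \<otimes>\<^bsub>T\<^esub> y \<otimes>\<^bsub>T\<^esub> inv\<^bsub>T\<^esub> x \<otimes>\<^bsub>T\<^esub> inv\<^bsub>T\<^esub> y \<in> \<phi> ` deep (1 + Suc n * q)"
      using commutator_deep[OF _ uv(1,3)] uv by (simp add: algebra_simps del: mult_eq)
  qed
  then show ?case
    using closedin_deep[of "1 + Suc n * q"] by (simp add: closure_of_minimal del: mult_eq)
qed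

lemma lcs_subset_carrier: "lcs (Suc n) \<subseteq> carrier T"
  using lcs_subset_deep[of n] subgroup.subset[OF subgroup_deep[of "1 + n * q"]] by auto

lemma commutator_in_lcs:
  assumes "x \<in> lcs (Suc n)" "y \<in> carrier T"
  shows "x \<otimes>\<^bsub>T\<^esub> y \<otimes>\<^bsub>T\<^esub> inv\<^bsub>T\<^esub> x \<otimes>\<^bsub>T\<^esub> inv\<^bsub>T\<^esub> y \<in> lcs (Suc (Suc n))"
proof -
  interpret T: group T by (rule group_T)
  let ?K = "{x \<otimes>\<^bsub>T\<^esub> y \<otimes>\<^bsub>T\<^esub> inv\<^bsub>T\<^esub> x \<otimes>\<^bsub>T\<^esub> inv\<^bsub>T\<^esub> y | x y. x \<in> lcs (Suc n) \<and> y \<in> carrier T}"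
  have "?K \<subseteq> carrier T"
    using lcs_subset_carrier by (auto simp del: mult_eq intro!: T.m_closed T.inv_closed)
  then have "generate T ?K \<subseteq> topspace (fesenko_topology q)"
    unfolding fesenko_topology_def using T.generate_incl by simp
  then have "generate T ?K \<subseteq> lcs (Suc (Suc n))" using closure_of_subset by simp
  moreover have "x \<otimes>\<^bsub>T\<^esub> y \<otimes>\<^bsub>T\<^esub> inv\<^bsub>T\<^esub> x \<otimes>\<^bsub>T\<^esub> inv\<^bsub>T\<^esub> y \<in> generate T ?K"
    using assms by (intro generate.incl) blast
  ultimately show ?thesis by blast
qed

text \<open>Induction by commutators with \<open>\<phi> (1 + fps_X)\<close>. The displacement of
  \<open>u\<close> has leading coefficient \<open>L\<close> times that of \<open>u - 1\<close>,
  nonzero since \<open>L\<close> is congruent to \<open>l\<close> modulo \<open>p\<close>, and the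
  other displacement has strictly larger order.\<close>

lemma lcs_exact_depth:
  assumes "l \<ge> 2" "\<not> p dvd l"
  shows "\<exists>u. u $ 0 = 1 \<and> subdegree (u - 1) = l + n * q \<and> \<phi> u \<in> lcs (Suc n)"
proof (induction n)
  case 0
  have "(1 + fps_X ^ l :: 'a fps) $ 0 = 1" using assms by simp
  then show ?case
    by (intro exI[of _ "1 + fps_X ^ l"]) (simp add: \<phi>_in_carrier fps_X_power_subdegree)
next
  case (Suc n)
  define L where "L = l + n * q"
  from Suc obtain u where u: "u $ 0 = 1" "subdegree (u - 1) = L" "\<phi> u \<in> lcs (Suc n)"
    by (auto simp: L_def)
  have L: "L \<ge> 2" using assms by (simp add: L_def)
  have "p dvd n * q" using r by (simp add: q dvd_power)
  with assms(2) have "\<not> p dvd L" unfolding L_def using dvd_add_left_iff by blast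
  then have L0: "of_nat L \<noteq> (0 :: 'a)" by (simp add: of_nat_eq_0_iff_char_dvd CHAR_eq)
  define v where "v = 1 + (fps_X :: 'a fps)"
  have v0: "v $ 0 = 1" by (simp add: v_def)
  have v1: "fps_X ^ 1 dvd v - 1" by (simp add: v_def)
  obtain w where w: "w $ 0 = 1"
      "\<phi> u \<otimes>\<^bsub>T\<^esub> \<phi> v \<otimes>\<^bsub>T\<^esub> inv\<^bsub>T\<^esub> \<phi> u \<otimes>\<^bsub>T\<^esub> inv\<^bsub>T\<^esub> \<phi> v = \<phi> w"
      "u * (v oo \<phi> u) * ((w - 1) oo (\<phi> v oo \<phi> u))
        = v * ((u oo \<phi> v) - u) - u * ((v oo \<phi> u) - v)" (is "_ = ?H")
    using commutator_\<phi> u(1) v0 by blast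
  have uL: "fps_X ^ L dvd u - 1"
    using u(2) by (auto simp: fps_X_power_dvd_iff)
  \<comment> \<open>The zero series has \<open>subdegree\<close> 0 by convention, so positivity
    shows that \<open>u - 1\<close> is nonzero.\<close>
  have "subdegree (u - 1) > 0" using u(2) L by simp
  then have u1: "(u - 1) $ L \<noteq> 0" using u(2) by (metis nth_subdegree_nonzero subdegree_0 less_irrefl)
  have "v ^ q = 1 + fps_X ^ q"
    using freshman_fps[of 1 fps_X r] by (simp add: v_def q)
  then have \<phi>v: "\<phi> v = fps_X * (1 + fps_X ^ q * 1)" by (simp add: \<phi>_def)
  have A: "fps_X ^ (L + q) dvd (u oo \<phi> v) - u"
    and A': "((u oo \<phi> v) - u) $ (L + q) = of_nat L * (u - 1) $ L"
    using fps_compose_diff_leading[OF \<phi>v _ uL] q_ge_2 unfolding compose_minus_one by auto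
  have "fps_X ^ (1 + q * L) dvd (v oo \<phi> u) - v"
    using compose_\<phi>_diff_dvd[OF v1 uL] L by (simp only: compose_minus_one)
  \<comment> \<open>This amounts to \<open>(q - 1) * (L - 1) \<ge> 1\<close>; here depth at least 2
    enters, to keep the second displacement from cancelling the leading term.\<close>
  moreover have "L + q + 1 \<le> 1 + q * L"
  proof -
    obtain a where "q = a + 2" using q_ge_2 le_Suc_ex by (metis add.commute)
    moreover obtain b where "L = b + 2" using L le_Suc_ex by (metis add.commute)
    ultimately show ?thesis by (simp add: algebra_simps)
  qed
  ultimately have B: "fps_X ^ (L + q + 1) dvd u * ((v oo \<phi> u) - v)"
    using power_le_dvd by (intro dvd_mult) blast
  obtain z where z: "(u oo \<phi> v) - u = fps_X ^ (L + q) * z" using A by blast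
  have z0: "z $ 0 \<noteq> 0" using A' u1 L0 unfolding z by (simp add: fps_X_power_mult_nth)
  obtain z' where z': "u * ((v oo \<phi> u) - v) = fps_X ^ (L + q + 1) * z'" using B by blast
  have "?H = fps_X ^ (L + q) * (v * z - fps_X * z')"
    unfolding z z' by (simp add: algebra_simps)
  then have H: "subdegree ?H = L + q"
    using z0 v0 by (intro subdegreeI) (auto simp: fps_X_power_mult_nth)
  have "subdegree (w - 1) = subdegree ?H"
  proof -
    have "?H \<noteq> 0" using H L by (metis add_is_0 not_numeral_le_zero subdegree_0)
    then have ne: "u * (v oo \<phi> u) * ((w - 1) oo (\<phi> v oo \<phi> u)) \<noteq> 0" by (simp only: w(3) not_False_eq_True)
    have 1: "subdegree (u * (v oo \<phi> u)) = 0" using u(1) v0 by (intro subdegreeI) auto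
    have "subdegree ((w - 1) oo (\<phi> v oo \<phi> u)) = subdegree (w - 1)"
      using subdegree_compose_\<phi>[OF v0 u(1)] by (subst subdegree_fps_compose) simp_all
    then show ?thesis using ne 1 unfolding w(3)[symmetric] by (subst subdegree_mult) auto
  qed
  then have "subdegree (w - 1) = l + Suc n * q" using H by (simp add: L_def)
  moreover have "\<phi> w \<in> lcs (Suc (Suc n))"
    using commutator_in_lcs[OF u(3) \<phi>_in_carrier[OF v0]] w(2) by simp
  ultimately show ?case using w(1) by blast
qed

subsection \<open>A normal subgroup with a gap in its depths\<close>

lemma dvd_mult_diff_cong:
  fixes x :: "'a fps"
  assumes "x dvd u - a" "x dvd v - c"
  shows "x dvd u * v - a * c"
proof -
  have "u * v - a * c = u * (v - c) + (u - a) * c" by (simp add: algebra_simps)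
  then show ?thesis using assms by simp
qed

text \<open>The value \<open>b = 0\<close> is allowed, so everything in \<open>deep (2 * d)\<close>
  is included. What is excluded are depths below \<open>d\<close> and depths strictly between
  \<open>d\<close> and \<open>2 * d\<close>.\<close>

definition near :: "nat \<Rightarrow> 'a fps set" where
  "near d = {u. \<exists>b. fps_X ^ (2 * d) dvd u - (1 + fps_const b * fps_X ^ d)}"

lemma near_nth_0:
  assumes "d \<ge> 1"
  shows "near d \<subseteq> {u. u $ 0 = 1}"
proof
  fix u assume "u \<in> near d"
  then obtain b where "fps_X ^ (2 * d) dvd u - (1 + fps_const b * fps_X ^ d)"
    by (auto simp: near_def)
  then have "(u - (1 + fps_const b * fps_X ^ d)) $ 0 = 0"
    using assms unfolding fps_X_power_dvd_iff by simp
  then show "u \<in> {u. u $ 0 = 1}" using assms by simp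
qed

lemma near_cong:
  assumes "u \<in> near d" "fps_X ^ (2 * d) dvd v - u"
  shows "v \<in> near d"
proof -
  obtain b where "fps_X ^ (2 * d) dvd u - (1 + fps_const b * fps_X ^ d)"
    using assms(1) by (auto simp: near_def)
  with assms(2) have "fps_X ^ (2 * d) dvd (v - u) + (u - (1 + fps_const b * fps_X ^ d))"
    by (rule dvd_add)
  then have "fps_X ^ (2 * d) dvd v - (1 + fps_const b * fps_X ^ d)"
    by (simp only: add_diff_eq diff_add_cancel)
  then show ?thesis unfolding near_def by blast
qed

text \<open>Since \<open>d\<close> is a power of \<open>p\<close>,
  \<open>\<phi> v ^ d - fps_X ^ d\<close> is the \<open>d\<close>-th power of
  \<open>\<phi> v - fps_X\<close>, a series of order at least 2. The term at
  \<open>fps_X ^ d\<close> is therefore fixed modulo \<open>fps_X ^ (2 * d)\<close>.\<close>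

lemma compose_near:
  assumes d: "d = p ^ e" and u: "u \<in> near d" and v: "v $ 0 = 1"
  shows "fps_X ^ (2 * d) dvd (u oo \<phi> v) - u"
proof -
  obtain b where "fps_X ^ (2 * d) dvd u - (1 + fps_const b * fps_X ^ d)"
    using u by (auto simp: near_def)
  then obtain z where "u - (1 + fps_const b * fps_X ^ d) = fps_X ^ (2 * d) * z" by blast
  then have u_eq: "u = 1 + fps_const b * fps_X ^ d + fps_X ^ (2 * d) * z"
    by (simp add: algebra_simps)
  have v1: "fps_X ^ 1 dvd v - 1" using v by (simp only: dvd_minus_one)
  have "fps_X ^ (2 * d + q * 1) dvd ((fps_X ^ (2 * d) * z) oo \<phi> v) - fps_X ^ (2 * d) * z"
    using compose_\<phi>_diff_dvd[OF _ v1, of "2 * d" "fps_X ^ (2 * d) * z"] by simp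
  then have A: "fps_X ^ (2 * d) dvd ((fps_X ^ (2 * d) * z) oo \<phi> v) - fps_X ^ (2 * d) * z"
    by (rule power_le_dvd) simp
  have "fps_X ^ (q * 1 + 1) dvd \<phi> v - \<phi> 1"
    unfolding \<phi>_diff[symmetric] \<phi>_dvd_iff by (rule v1)
  then have "fps_X ^ 2 dvd \<phi> v - fps_X"
    using q_ge_2 unfolding \<phi>_one by (elim power_le_dvd) simp
  then have "(fps_X ^ 2) ^ d dvd (\<phi> v - fps_X) ^ d" by (rule dvd_power_same)
  then have B: "fps_X ^ (2 * d) dvd \<phi> v ^ d - fps_X ^ d"
    unfolding d freshman_diff_fps power_mult .
  have "(u oo \<phi> v) - u = fps_const b * (\<phi> v ^ d - fps_X ^ d)
      + (((fps_X ^ (2 * d) * z) oo \<phi> v) - fps_X ^ (2 * d) * z)"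
    unfolding u_eq
    by (simp add: fps_compose_add_distrib fps_compose_mult_distrib fps_X_power_compose algebra_simps)
  then show ?thesis using A B by (metis dvd_add dvd_mult)
qed

text \<open>Modulo \<open>fps_X ^ (2 * d)\<close> the cross terms vanish, so multiplication of
  coordinates adds the parameters \<open>b\<close>, inversion negates them, and substitution
  preserves them by \<open>compose_near\<close>.\<close>

lemma subgroup_near:
  assumes d: "d = p ^ e"
  shows "subgroup (\<phi> ` near d) T"
proof (rule subgroup_\<phi>)
  have d1: "d \<ge> 1" using d prime_p by (simp add: prime_gt_0_nat Suc_leI)
  have sq: "fps_X ^ (2 * d) dvd (fps_const b * fps_X ^ d) * (fps_const c * fps_X ^ d)"
    for b c :: 'a
  proof -
    have "(fps_const b * fps_X ^ d) * (fps_const c * fps_X ^ d)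
        = fps_X ^ (2 * d) * (fps_const b * fps_const c)"
      unfolding mult_2 power_add by (simp only: mult_ac)
    then show ?thesis by (simp only: dvd_triv_left)
  qed
  show "near d \<subseteq> {u. u $ 0 = 1}" using d1 by (rule near_nth_0)
  show "1 \<in> near d" by (auto simp: near_def intro!: exI[of _ 0])
  show "u oo \<phi> v \<in> near d" if "u \<in> near d" "v $ 0 = 1" for u v
    using near_cong compose_near[OF d] that by blast
  show "u * v \<in> near d" if "u \<in> near d" "v \<in> near d" for u v
  proof -
    obtain b c where bc: "fps_X ^ (2 * d) dvd u - (1 + fps_const b * fps_X ^ d)"
      "fps_X ^ (2 * d) dvd v - (1 + fps_const c * fps_X ^ d)"
      using \<open>u \<in> near d\<close> \<open>v \<in> near d\<close> by (auto simp: near_def)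
    have "u * v - (1 + fps_const (b + c) * fps_X ^ d)
      = u * v - (1 + fps_const b * fps_X ^ d) * (1 + fps_const c * fps_X ^ d)
        + (fps_const b * fps_X ^ d) * (fps_const c * fps_X ^ d)"
      by (simp add: algebra_simps flip: fps_const_add)
    then have "fps_X ^ (2 * d) dvd u * v - (1 + fps_const (b + c) * fps_X ^ d)"
      using dvd_mult_diff_cong[OF bc] sq by (metis dvd_add)
    then show ?thesis unfolding near_def by blast
  qed
  show "inverse u \<in> near d" if u: "u \<in> near d" for u
  proof -
    obtain b where b: "fps_X ^ (2 * d) dvd u - (1 + fps_const b * fps_X ^ d)"
      using u by (auto simp: near_def)
    let ?B = "fps_const b * fps_X ^ d"
    have "u $ 0 \<noteq> 0" using near_nth_0[OF d1] u by auto
    then have "inverse u * u = 1" by (rule inverse_mult_eq_1)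
    \<comment> \<open>This is \<open>(1 + ?B) * (1 - ?B) = 1 - ?B * ?B\<close>, with the error of
      \<open>u\<close> against \<open>1 + ?B\<close> carried along; it exhibits
      \<open>1 - ?B\<close> as an approximate inverse.\<close>
    moreover have "inverse u * (?B * ?B - (u - (1 + ?B)) * (1 - ?B))
        = inverse u - inverse u * u * (1 - ?B)"
      by (simp add: algebra_simps)
    ultimately have "inverse u * (?B * ?B - (u - (1 + ?B)) * (1 - ?B)) = inverse u - (1 - ?B)"
      by (simp only: mult_1)
    moreover have "1 - ?B = 1 + fps_const (- b) * fps_X ^ d"
      by (simp flip: fps_const_neg)
    ultimately have "inverse u - (1 + fps_const (- b) * fps_X ^ d)
        = inverse u * (?B * ?B - (u - (1 + ?B)) * (1 - ?B))"
      by (simp only:)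
    moreover have "fps_X ^ (2 * d) dvd ?B * ?B - (u - (1 + ?B)) * (1 - ?B)"
      by (intro dvd_diff dvd_mult2 b sq)
    ultimately have "fps_X ^ (2 * d) dvd inverse u - (1 + fps_const (- b) * fps_X ^ d)"
      by (metis dvd_mult)
    then show ?thesis unfolding near_def by blast
  qed
qed

lemma closedin_near:
  assumes "d \<ge> 1"
  shows "closedin (fesenko_topology q) (\<phi> ` near d)"
  using near_nth_0[OF assms] near_cong assms by (intro closedin_\<phi>[where m = "2 * d"]) auto

text \<open>Conjugation changes the coordinate \<open>u\<close> only modulo
  \<open>fps_X ^ (2 * d)\<close>. The displacement of \<open>v\<close> has order at least
  \<open>1 + q * d\<close> because \<open>u\<close> has depth at least \<open>d\<close>, and that of
  \<open>u\<close> is controlled by \<open>compose_near\<close>.\<close>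

lemma normal_near:
  assumes d: "d = p ^ e"
  shows "\<phi> ` near d \<lhd> T"
proof -
  interpret T: group T by (rule group_T)
  have d1: "d \<ge> 1" using d prime_p by (simp add: prime_gt_0_nat Suc_leI)
  have "x \<otimes>\<^bsub>T\<^esub> h \<otimes>\<^bsub>T\<^esub> inv\<^bsub>T\<^esub> x \<in> \<phi> ` near d" if x: "x \<in> carrier T" and h: "h \<in> \<phi> ` near d" for x h
  proof -
    obtain u where u: "u \<in> near d" "u $ 0 = 1" "h = \<phi> u" using h near_nth_0[OF d1] by blast
    obtain v where v: "v $ 0 = 1" "x = \<phi> v" using x by (auto simp: carrier_eq)
    have hc: "h \<in> carrier T" using u by (simp add: \<phi>_in_carrier)
    have "x \<otimes>\<^bsub>T\<^esub> h \<otimes>\<^bsub>T\<^esub> inv\<^bsub>T\<^esub> x \<in> carrier T" using x hc by (intro T.m_closed T.inv_closed)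
    then obtain w where w: "w $ 0 = 1" "x \<otimes>\<^bsub>T\<^esub> h \<otimes>\<^bsub>T\<^esub> inv\<^bsub>T\<^esub> x = \<phi> w"
      unfolding carrier_eq by blast
    have "x \<otimes>\<^bsub>T\<^esub> h \<otimes>\<^bsub>T\<^esub> inv\<^bsub>T\<^esub> x \<otimes>\<^bsub>T\<^esub> x = x \<otimes>\<^bsub>T\<^esub> h"
      using x hc by (simp add: T.m_assoc del: mult_eq one_eq)
    then have "\<phi> w oo \<phi> v = \<phi> v oo \<phi> u" unfolding w(2) by (simp add: u v)
    then have "v * (w oo \<phi> v) = u * (v oo \<phi> u)" by (simp add: \<phi>_compose)
    then have eq: "v * ((w - u) oo \<phi> v) = u * ((v oo \<phi> u) - v) - v * ((u oo \<phi> v) - u)"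
      by (simp add: fps_compose_sub_distrib algebra_simps)
    have v1: "fps_X ^ 1 dvd v - 1" using v(1) by (simp only: dvd_minus_one)
    obtain b where "fps_X ^ (2 * d) dvd u - (1 + fps_const b * fps_X ^ d)"
      using u by (auto simp: near_def)
    then have "fps_X ^ d dvd (u - (1 + fps_const b * fps_X ^ d)) + fps_const b * fps_X ^ d"
      by (intro dvd_add dvd_triv_right) (auto elim: power_le_dvd)
    then have ud: "fps_X ^ d dvd u - 1" by simp
    have "fps_X ^ (1 + q * d) dvd (v oo \<phi> u) - v"
      using compose_\<phi>_diff_dvd[OF v1 ud d1] by (simp only: compose_minus_one)
    moreover have "2 * d \<le> 1 + q * d" using q_ge_2 by (simp add: le_SucI)
    ultimately have v2d: "fps_X ^ (2 * d) dvd (v oo \<phi> u) - v" by (rule power_le_dvd)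
    have "fps_X ^ (2 * d) dvd v * ((w - u) oo \<phi> v)"
      unfolding eq by (intro dvd_diff dvd_mult v2d compose_near[OF d u(1) v(1)])
    then have "fps_X ^ (2 * d) dvd (w - u) oo \<phi> v"
      using v by (elim fps_X_power_dvd_unit_multD) simp
    then have "fps_X ^ (2 * d) dvd w - u"
      using subdegree_\<phi>[OF v(1)] by (rule fps_X_power_dvd_composeD)
    then show ?thesis using near_cong[OF u(1)] w(2) by simp
  qed
  then show ?thesis using subgroup_near[OF d] T.normal_inv_iff by blast
qed

subsection \<open>The index of the oblique core\<close>

lemma one_in_lcs: "\<one>\<^bsub>T\<^esub> \<in> lcs (Suc n)"
proof (induction n)
  case 0
  show ?case using monoid.one_closed[OF group.is_monoid[OF group_T]] by simp
next
  case (Suc n)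
  interpret T: group T by (rule group_T)
  show ?case
    using commutator_in_lcs[OF Suc T.one_closed] by (simp del: mult_eq one_eq lower_central_series.simps)
qed

text \<open>The image of \<open>near (n * q)\<close> is one of the intersected subgroups:
  \<open>1 + fps_X ^ (n * q)\<close> gives an element of depth \<open>n * q\<close>, just too
  shallow for the term of index \<open>n + 1\<close>.\<close>

lemma oblique_core_subset_near:
  assumes "n * q = p ^ e"
  shows "oblique_core (fesenko_topology q) T n \<subseteq> \<phi> ` near (n * q)"
proof -
  let ?d = "n * q"
  have "?d \<ge> 1" using assms prime_p by (simp add: prime_gt_0_nat Suc_leI)
  have "1 + fps_X ^ ?d \<in> near ?d"
    unfolding near_def by (auto intro!: exI[of _ 1])
  moreover have "1 + fps_X ^ ?d \<notin> deep (1 + ?d)"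
    by (auto simp: deep_def fps_X_power_dvd_iff simp del: power_Suc intro!: exI[of _ ?d])
  ultimately have "\<not> \<phi> ` near ?d \<subseteq> lcs (Suc n)"
    using lcs_subset_deep[of n] by (auto simp del: lower_central_series.simps dest!: subsetD)
  then show ?thesis
    using normal_near[OF assms] closedin_near[OF \<open>?d \<ge> 1\<close>]
    unfolding oblique_core_def by (simp del: lower_central_series.simps) blast
qed

lemma one_in_oblique_core: "\<one>\<^bsub>T\<^esub> \<in> oblique_core (fesenko_topology q) T n"
  using one_in_lcs subgroup.one_closed[OF normal_imp_subgroup]
  unfolding oblique_core_def by (auto simp del: lower_central_series.simps one_eq)

text \<open>Modulo \<open>fps_X ^ (2 * d)\<close> the coordinates differ by
  \<open>b * fps_X ^ d * v\<close>. Both depths exceed \<open>d\<close>, so comparing coefficients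
  at \<open>d\<close> gives \<open>b = 0\<close>; the coordinates then agree below
  \<open>2 * d\<close>, where both depths lie.\<close>

lemma same_near_coset_depth:
  assumes d: "d = p ^ e" and k: "k \<in> near d" and v: "v $ 0 = 1"
    and eq: "\<phi> u = \<phi> k oo \<phi> v"
    and u: "subdegree (u - 1) \<in> {d<..<2 * d}" and v': "subdegree (v - 1) \<in> {d<..<2 * d}"
  shows "subdegree (u - 1) = subdegree (v - 1)"
proof -
  have ukv: "u = v * (k oo \<phi> v)" using eq by (simp add: \<phi>_compose)
  obtain b where b: "fps_X ^ (2 * d) dvd k - (1 + fps_const b * fps_X ^ d)"
    using k by (auto simp: near_def)
  have "fps_X ^ (2 * d) dvd v * (((k oo \<phi> v) - k) + (k - (1 + fps_const b * fps_X ^ d)))"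
    by (intro dvd_mult dvd_add b compose_near[OF d k v])
  also have "\<dots> = (u - 1) - (v - 1) - fps_const b * (fps_X ^ d * v)"
    unfolding ukv by (simp add: algebra_simps)
  finally have cong: "(u - 1) $ j - (v - 1) $ j = (fps_const b * (fps_X ^ d * v)) $ j"
    if "j < 2 * d" for j
    using that unfolding fps_X_power_dvd_iff by simp
  have z: "(u - 1) $ j = 0" if "j < subdegree (u - 1)" for j using that by blast
  have z': "(v - 1) $ j = 0" if "j < subdegree (v - 1)" for j using that by blast
  have "b = 0"
    using cong[of d] z[of d] z'[of d] u v' v by (auto simp: fps_X_power_mult_nth)
  with cong have cong0: "(u - 1) $ j = (v - 1) $ j" if "j < 2 * d" for j
    using that by auto
  have nz: "(u - 1) $ subdegree (u - 1) \<noteq> 0" "(v - 1) $ subdegree (v - 1) \<noteq> 0"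
    using u v' by (intro nth_subdegree_nonzero; force)+
  show ?thesis
    using nz z z' cong0 u v' by (metis greaterThanLessThan_iff linorder_neqE_nat)
qed

text \<open>The choice \<open>n = p ^ i\<close> makes \<open>n * q\<close> a power of
  \<open>p\<close>. Elements of distinct depths in the gap of \<open>near\<close> then give distinct
  cosets of the oblique core.\<close>

lemma log_index_ge:
  assumes i: "i \<ge> 1"
  shows "ereal (real i - 1) \<le> log_index p T (lcs (p ^ i + 1)) (oblique_core (fesenko_topology q) T (p ^ i))"
proof -
  define n where "n = p ^ i"
  define d where "d = n * q"
  \<comment> \<open>\<open>M\<close> is \<open>d\<close> divided by \<open>p\<close>, so the depths
    \<open>1 + p * x + d\<close> with \<open>x < M\<close> stay below \<open>2 * d\<close>. Starting
    at \<open>x = 1\<close> makes \<open>1 + p * x\<close> at least 2, as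
    \<open>lcs_exact_depth\<close> requires.\<close>
  define M where "M = p ^ (r + i - 1)"
  let ?G = "T\<lparr>carrier := lcs (Suc n)\<rparr>" and ?K = "oblique_core (fesenko_topology q) T n"
  have p2: "p \<ge> 2" using prime_p by (rule prime_ge_2_nat)
  have d: "d = p ^ (r + i)" by (simp add: d_def n_def q power_add)
  have dM: "d = p * M" using r by (simp add: d M_def flip: power_Suc)
  have "\<exists>u. u $ 0 = 1 \<and> subdegree (u - 1) = 1 + p * x + d \<and> \<phi> u \<in> lcs (Suc n)"
    if "x \<in> {1..<M}" for x
  proof -
    have "p dvd 1 + p * x \<longleftrightarrow> p dvd 1" by (rule dvd_add_left_iff) simp
    then have "\<not> p dvd 1 + p * x" using p2 by simp
    moreover have "p * x \<ge> 1" using that p2 by simp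
    ultimately show ?thesis using lcs_exact_depth[of "1 + p * x" n] by (simp add: d_def)
  qed
  then obtain u where u: "\<And>x. x \<in> {1..<M} \<Longrightarrow>
      u x $ 0 = 1 \<and> subdegree (u x - 1) = 1 + p * x + d \<and> \<phi> (u x) \<in> lcs (Suc n)"
    by metis
  define C where "C x = ?K #>\<^bsub>?G\<^esub> \<phi> (u x)" for x
  have depth: "subdegree (u x - 1) \<in> {d<..<2 * d}" if "x \<in> {1..<M}" for x
  proof -
    have "p * (x + 1) \<le> d" unfolding dM using that by (intro mult_le_mono2) simp
    then show ?thesis using u[OF that] p2 by simp
  qed
  have "inj_on C {1..<M}"
  proof (rule inj_onI)
    fix x y assume x: "x \<in> {1..<M}" and y: "y \<in> {1..<M}" and "C x = C y"
    moreover have "\<phi> (u x) \<in> C x"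
      using one_in_oblique_core[of n] unfolding C_def r_coset_def by (auto intro!: bexI[of _ fps_X])
    ultimately obtain h where "h \<in> ?K" "\<phi> (u x) = h oo \<phi> (u y)"
      unfolding C_def r_coset_def by auto
    then obtain k where k: "k \<in> near d" "\<phi> (u x) = \<phi> k oo \<phi> (u y)"
      using oblique_core_subset_near[of n "r + i"] d unfolding d_def by blast
    have "subdegree (u x - 1) = subdegree (u y - 1)"
      using same_near_coset_depth[OF d k(1) _ k(2) depth[OF x] depth[OF y]] u[OF y] by blast
    then show "x = y" using u[OF x] u[OF y] p2 by simp
  qed
  then have card_C: "card (C ` {1..<M}) = M - 1" by (simp add: card_image)
  have C: "C ` {1..<M} \<subseteq> rcosets\<^bsub>?G\<^esub> ?K"
  proof (rule image_subsetI)
    fix x assume "x \<in> {1..<M}"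
    then have "\<phi> (u x) \<in> carrier ?G" using u by simp
    then show "C x \<in> rcosets\<^bsub>?G\<^esub> ?K" unfolding C_def RCOSETS_def by blast
  qed
  have "real i - 1 \<le> log (real p) (real (card (rcosets\<^bsub>?G\<^esub> ?K)))" if "finite (rcosets\<^bsub>?G\<^esub> ?K)"
  proof -
    \<comment> \<open>There are \<open>M - 1\<close> cosets, and
      \<open>M - 1 \<ge> 2 * p ^ (i - 1) - 1 \<ge> p ^ (i - 1)\<close>.\<close>
    have "p ^ i \<le> M" unfolding M_def using p2 r by (intro power_increasing) auto
    moreover have "p ^ i \<ge> 2 * p ^ (i - 1)" using p2 i by (cases i) auto
    moreover have "p ^ (i - 1) \<ge> 1" using p2 by simp
    ultimately have "p ^ (i - 1) \<le> card (rcosets\<^bsub>?G\<^esub> ?K)"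
      using card_mono[OF that C] card_C by linarith
    then have "real p ^ (i - 1) \<le> real (card (rcosets\<^bsub>?G\<^esub> ?K))" by (simp flip: of_nat_power)
    then have "real (i - 1) \<le> log (real p) (real (card (rcosets\<^bsub>?G\<^esub> ?K)))"
      using p2 by (intro le_log_of_power) auto
    then show ?thesis using i by simp
  qed
  then have "ereal (real i - 1) \<le> log_index p T (lcs (Suc n)) ?K"
    unfolding log_index_def Let_def by auto
  then show ?thesis by (simp add: n_def del: lower_central_series.simps)
qed

end

section \<open>Unboundedness of the logarithmic index\<close>

theorem proposition4p1:
  fixes p r :: nat
  assumes "prime p" and "r \<ge> 1" and "CARD('a::field) = p"
  shows "obliquity p (fesenko_topology (p ^ r)) (fesenko_group (p ^ r) :: 'a fps monoid) = \<infinity>"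
proof (rule ereal_top)
  interpret fesenko p r "p ^ r" "TYPE('a)" using assms by unfold_locales simp_all
  fix B :: real
  \<comment> \<open>For negative \<open>B\<close> the function \<open>nat\<close> returns 0, so
    \<open>i \<ge> 1\<close> and \<open>B \<le> i - 1\<close> hold in every case.\<close>
  define i where "i = nat \<lceil>B\<rceil> + 1"
  have "B \<le> real i - 1" unfolding i_def by linarith
  then have "ereal B \<le> ereal (real i - 1)" by simp
  also have "\<dots> \<le> log_index p T (lcs (p ^ i + 1)) (oblique_core (fesenko_topology (p ^ r)) T (p ^ i))"
    by (rule log_index_ge) (simp add: i_def)
  also have "\<dots> \<le> obliquity p (fesenko_topology (p ^ r)) T"
    unfolding obliquity_def using assms(1)
    by (intro SUP_upper) (simp add: prime_gt_0_nat Suc_leI)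
  finally show "ereal B \<le> obliquity p (fesenko_topology (p ^ r)) (fesenko_group (p ^ r) :: 'a fps monoid)" .
qed

end
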